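(* Let $G$ be a finite simple graph of order $n$ with maximum degree $\Delta(G)$, and let $r$ be an integer with $4\le r\le \frac{\Delta(G)}{2}$ and $n>2r$. Suppose that $G$ is $(n-2r+1)$-connected and that $G$ has no induced subgraph isomorphic to $K_{r,r+1}$ and no induced subgraph isomorphic to $K_{r+1,r+1}$. Then $$\chi_{D_L}(G)\le 2\Delta(G)-\left(3\left\lfloor\frac{\Delta(G)+2}{r+1}\right\rfloor-4\right).$$
   Context: All graphs are finite and simple. $K_{s,t}$ denotes the complete bipartite graph with parts of sizes $s$ and $t$. A graph is $k$-connected if it has at least $k+1$ vertices and removal of any $k-1$ or fewer vertices leaves a connected graph. Given an assignment $L=\{L(v)\}_{v\in V(G)}$ of lists of available colors to the vertices of $G$, the graph $G$ is properly $L$-distinguishable if there is a proper vertex coloring $f$ of $G$ such that $f(v)\in L(v)$ for all $v\in V(G)$ and the only automorphism $\phi$ of $G$ preserving $f$ (i.e. $f(\phi(v))=f(v)$ for all $v$) is the identity. The list-distinguishing chromatic number $\chi_{D_L}(G)$ is the minimum integer $k$ such that $G$ is properly $L$-distinguishable for every list assignment $L$ with $|L(v)|=k$ for all $v\in V(G)$. *)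

theory Defs
  imports Complex_Main "Graph_Theory.Graph_Theory"
begin

text \<open>
  Finite simple graphs are represented as in the Graph Theory library, as finite symmetric
  digraphs without loops and parallel arcs (locale \<^locale>\<open>graph\<close>): an undirected edge
  is a pair of opposite arcs. Hence the out-degree of a vertex is its degree.
\<close>

definition max_degree :: "('a, 'b) pre_digraph \<Rightarrow> nat" where
  "max_degree G = Max (out_degree G ` verts G)"

text \<open>
  Note that \<open>Digraph_Component.connected\<close> is false of the null graph; this plays no role here,
  because fewer than \<open>k\<close> vertices are removed from at least \<open>k + 1\<close>.
\<close>

definition k_connected :: "nat \<Rightarrow> ('a, 'b) pre_digraph \<Rightarrow> bool" where
  "k_connected k G \<longleftrightarrow> k + 1 \<le> card (verts G) \<and>
     (\<forall>S \<subseteq> verts G. card S < k \<longrightarrow> Digraph_Component.connected (G \<restriction> (verts G - S)))"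

text \<open>
  In a simple graph the action on vertices determines the action on arcs, so an automorphism
  is given by its vertex map; only the values on the vertices of the graph matter.
\<close>

definition automorphism :: "('a, 'b) pre_digraph \<Rightarrow> ('a \<Rightarrow> 'a) \<Rightarrow> bool" where
  "automorphism G \<phi> \<longleftrightarrow> bij_betw \<phi> (verts G) (verts G) \<and>
     (\<forall>u \<in> verts G. \<forall>v \<in> verts G. u \<rightarrow>\<^bsub>G\<^esub> v \<longleftrightarrow> \<phi> u \<rightarrow>\<^bsub>G\<^esub> \<phi> v)"

definition proper_coloring :: "('a, 'b) pre_digraph \<Rightarrow> ('a \<Rightarrow> 'c) \<Rightarrow> bool" where
  "proper_coloring G f \<longleftrightarrow> (\<forall>u v. u \<rightarrow>\<^bsub>G\<^esub> v \<longrightarrow> f u \<noteq> f v)"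

definition properly_list_distinguishable :: "('a, 'b) pre_digraph \<Rightarrow> ('a \<Rightarrow> 'c set) \<Rightarrow> bool" where
  "properly_list_distinguishable G L \<longleftrightarrow>
     (\<exists>f. proper_coloring G f \<and> (\<forall>v \<in> verts G. f v \<in> L v) \<and>
        (\<forall>\<phi>. automorphism G \<phi> \<and> (\<forall>v \<in> verts G. f (\<phi> v) = f v) \<longrightarrow> (\<forall>v \<in> verts G. \<phi> v = v)))"

text \<open>
  Colors are natural numbers. This is no restriction, as a finite graph with finite lists
  involves only finitely many colors. The minimum exists for every finite graph, since lists
  of size \<open>card (verts G)\<close> allow all vertices to get different colors.
\<close>

definition list_distinguishing_chromatic_number :: "('a, 'b) pre_digraph \<Rightarrow> nat" where
  "list_distinguishing_chromatic_number G =
     (LEAST k. \<forall>L :: 'a \<Rightarrow> nat set.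
        (\<forall>v \<in> verts G. finite (L v) \<and> card (L v) = k) \<longrightarrow> properly_list_distinguishable G L)"

end

theory Submission
  imports Defs
begin

text \<open>
  The bound is so weak under the connectivity hypothesis that almost all colors may be taken
  distinct. Write \<open>\<Delta>\<close> for the maximum degree and \<open>q = \<lfloor>(\<Delta> + 2) / (r + 1)\<rfloor>\<close>. A
  \<open>k\<close>-connected graph has minimum degree at least \<open>k\<close>, because deleting the neighbors of a vertex
  isolates it (\<open>k_connected_le_out_degree\<close>). Hence \<open>n - 2 r + 1 \<le> \<Delta>\<close>, that is,
  \<open>n \<le> \<Delta> + 2 r - 1\<close>. From lists of size \<open>n\<close> all vertices can get different colors, so
  \<open>n\<close> is an upper bound for the list-distinguishing chromatic number.

  As \<open>q \<ge> 2\<close> and \<open>q (r + 1) \<le> \<Delta> + 2\<close>, arithmetic shows that \<open>\<Delta> + 2 r - 1\<close> is at most the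
  claimed bound \<open>2 \<Delta> - 3 q + 4\<close>, except if \<open>\<Delta> = 2 r\<close>, when it exceeds the bound by one. So
  the only remaining case is \<open>\<Delta> = 2 r\<close> and \<open>n = 4 r - 1\<close>, and then the minimum degree is also
  at least \<open>2 r\<close>, so the graph is \<open>2 r\<close>-regular.

  In that case \<open>n - 1\<close> colors have to suffice. They do as soon as some two nonadjacent vertices
  have different neighborhoods (\<open>list_distinguishing_chromatic_number_le_pred_card\<close>): if two lists
  differ, all vertices can still get different colors; if all lists are equal, these two vertices
  share a color, and no automorphism exchanges them while fixing all other vertices. If there
  were no such two vertices, the graph would be complete multipartite, and by regularity
  the parts would all have \<open>n - 2 r = 2 r - 1\<close> vertices. But \<open>2 r - 1\<close> does not divide \<open>4 r - 1\<close>.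
\<close>

section \<open>Injective choices from lists\<close>

lemma ex_inj_on_choice:
  fixes L :: "'a \<Rightarrow> 'c set"
  assumes "finite A" and "\<And>v. v \<in> A \<Longrightarrow> finite (L v) \<and> card A \<le> card (L v)"
  shows "\<exists>f. inj_on f A \<and> (\<forall>v\<in>A. f v \<in> L v)"
  using assms
proof (induction A rule: finite_induct)
  case empty
  then show ?case by simp
next
  case (insert a A)
  have "finite (L v) \<and> card A \<le> card (L v)" if "v \<in> A" for v
    using insert.prems[of v] insert.hyps that by auto
  then obtain f where f: "inj_on f A" "\<forall>v\<in>A. f v \<in> L v"
    using insert.IH by blast
  have "card (f ` A) < card (L a)"
    using card_image_le[OF insert.hyps(1), of f] insert.prems[of a] insert.hyps by simp
  then obtain c where c: "c \<in> L a" "c \<notin> f ` A"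
    using insert.hyps(1) by (metis card_mono finite_imageI leD subsetI)
  have "inj_on (f(a := c)) (insert a A)"
    using f(1) c(2) insert.hyps(2) by (auto simp: inj_on_def)
  moreover have "\<forall>v\<in>insert a A. (f(a := c)) v \<in> L v"
    using f(2) c(1) by auto
  ultimately show ?case by blast
qed

text \<open>
  One color less than vertices is enough if two lists differ, by Hall's theorem. Directly: color
  \<open>x\<close> by a color missing from the list of \<open>y\<close>, then all vertices but \<open>y\<close>; the colors used so far
  rule out at most \<open>card A - 2\<close> colors of \<open>y\<close>.
\<close>

lemma ex_inj_on_choice_pred:
  fixes L :: "'a \<Rightarrow> 'c set"
  assumes fin: "finite A"
    and lists: "\<And>v. v \<in> A \<Longrightarrow> finite (L v) \<and> card (L v) = card A - 1"
    and xy: "x \<in> A" "y \<in> A" "L x \<noteq> L y"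
  shows "\<exists>f. inj_on f A \<and> (\<forall>v\<in>A. f v \<in> L v)"
proof -
  have "\<not> L x \<subseteq> L y"
    using lists[OF xy(1)] lists[OF xy(2)] xy(3) card_subset_eq by metis
  then obtain c where c: "c \<in> L x" "c \<notin> L y"
    by blast
  define B where "B = A - {x, y}"
  have "x \<noteq> y"
    using xy(3) by auto
  have A: "A = insert x (insert y B)" "x \<notin> insert y B" "y \<notin> B" "finite B"
    using xy fin \<open>x \<noteq> y\<close> by (auto simp: B_def)
  have cA: "card A = card B + 2"
    using A by simp
  have "finite (L v - {c}) \<and> card B \<le> card (L v - {c})" if "v \<in> B" for v
    using lists[of v] that cA A(1) by (auto simp: card_Diff_singleton_if)
  then obtain f where f: "inj_on f B" "\<forall>v\<in>B. f v \<in> L v - {c}"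
    using ex_inj_on_choice[OF A(4), of "\<lambda>v. L v - {c}"] by blast
  have "card (f ` B) < card (L y)"
    using card_image_le[OF A(4), of f] lists[OF xy(2)] cA by simp
  then obtain d where d: "d \<in> L y" "d \<notin> f ` B"
    using A(4) by (metis card_mono finite_imageI leD subsetI)
  define g where "g = f(x := c, y := d)"
  have g: "g x = c" "g y = d" "\<And>v. v \<in> B \<Longrightarrow> g v = f v"
    using A \<open>x \<noteq> y\<close> by (auto simp: g_def)
  have "inj_on g B"
    using f(1) g(3) by (simp add: inj_on_def)
  moreover have "g ` B = f ` B"
    using g(3) by (rule image_cong[OF refl])
  moreover have "c \<noteq> d" "c \<notin> f ` B"
    using c(2) d(1) f(2) by auto
  ultimately have "inj_on g A"
    using A(2,3) g(1,2) d(2) unfolding A(1) by auto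
  moreover have "\<forall>v\<in>A. g v \<in> L v"
    using g f(2) c(1) d(1) unfolding A(1) by auto
  ultimately show ?thesis by blast
qed

section \<open>Degrees\<close>

lemma (in nomulti_digraph) card_neighbors:
  "card {w. v \<rightarrow>\<^bsub>G\<^esub> w} = out_degree G v"
proof -
  have "{w. v \<rightarrow>\<^bsub>G\<^esub> w} = head G ` out_arcs G v"
    by (auto simp: out_arcs_def arcs_ends_def arc_to_ends_def)
  moreover have "inj_on (head G) (out_arcs G v)"
    using no_multi_arcs by (auto simp: inj_on_def out_arcs_def arc_to_ends_def)
  ultimately show ?thesis
    by (simp add: card_image out_degree_def)
qed

lemma (in graph) out_degree_le_max_degree:
  assumes "v \<in> verts G"
  shows "out_degree G v \<le> max_degree G"
  unfolding max_degree_def using assms by (intro Max_ge) auto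

text \<open>
  If \<open>v\<close> had fewer than \<open>k\<close> neighbors, deleting them would leave \<open>v\<close> isolated, together with at
  least one further vertex because there are more than \<open>k\<close> vertices.
\<close>

lemma (in graph) k_connected_le_out_degree:
  assumes conn: "k_connected k G" and v: "v \<in> verts G"
  shows "k \<le> out_degree G v"
proof (rule ccontr)
  assume "\<not> k \<le> out_degree G v"
  define S where "S = {w. v \<rightarrow>\<^bsub>G\<^esub> w}"
  have S: "S \<subseteq> verts G" "v \<notin> S"
    unfolding S_def using adj_not_same by (auto simp: adj_in_verts)
  have cS: "card S < k"
    using \<open>\<not> k \<le> out_degree G v\<close> by (simp add: S_def card_neighbors)
  define H where "H = G \<restriction> (verts G - S)"
  have "Digraph_Component.connected H"
    using conn S(1) cS by (simp add: k_connected_def H_def)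
  moreover have "wf_digraph H"
    unfolding H_def by (rule wellformed_induce_subgraph)
  moreover have "symmetric H"
  proof -
    have "arcs_ends H = arcs_ends G \<inter> (verts G - S) \<times> (verts G - S)"
      by (auto simp: H_def arcs_ends_def arc_to_ends_def)
    then show ?thesis
      using sym_arcs by (auto simp: symmetric_def sym_def)
  qed
  ultimately have sc: "strongly_connected H"
    by (simp add: wf_digraph.symmetric_connected_imp_strongly_connected)
  have "card (insert v S) < card (verts G)"
    using conn cS S finite_subset[OF S(1)] by (simp add: k_connected_def)
  then obtain w where w: "w \<in> verts G" "w \<noteq> v" "w \<notin> S"
    using v S(1) by (metis card_mono finite.insertI finite_subset finite_verts insertI1 insertI2 leD subsetI)
  have "v \<rightarrow>\<^sup>*\<^bsub>H\<^esub> w"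
    using sc v w S(2) by (auto simp: strongly_connected_def H_def)
  then obtain u where "v \<rightarrow>\<^bsub>H\<^esub> u"
    using w(2) by (auto elim: pre_digraph.converse_reachable_cases)
  then have "v \<rightarrow>\<^bsub>G\<^esub> u" "u \<notin> S"
    by (auto simp: H_def arcs_ends_def arc_to_ends_def)
  then show False
    by (simp add: S_def)
qed

section \<open>Colorings with few coincidences\<close>

context graph
begin

lemma inj_on_imp_properly_list_distinguishable:
  assumes inj: "inj_on f (verts G)" and lists: "\<forall>v\<in>verts G. f v \<in> L v"
  shows "properly_list_distinguishable G L"
  unfolding properly_list_distinguishable_def
proof (intro exI[of _ f] conjI allI impI lists ballI)
  show "proper_coloring G f"
    unfolding proper_coloring_def using inj adj_not_same
    by (metis adj_in_verts inj_onD)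
next
  fix \<phi> v
  assume "automorphism G \<phi> \<and> (\<forall>v\<in>verts G. f (\<phi> v) = f v)" and "v \<in> verts G"
  then show "\<phi> v = v"
    using inj unfolding automorphism_def by (meson bij_betwE inj_onD)
qed

text \<open>
  A color-preserving permutation fixes all vertices outside \<open>{x, y}\<close>. If it exchanged \<open>x\<close> and \<open>y\<close>,
  it would map the edge from \<open>x\<close> to \<open>w\<close> to a nonedge.
\<close>

lemma one_coincidence_imp_properly_list_distinguishable:
  assumes xy: "x \<in> verts G" "\<not> x \<rightarrow>\<^bsub>G\<^esub> y"
    and w: "x \<rightarrow>\<^bsub>G\<^esub> w" "\<not> y \<rightarrow>\<^bsub>G\<^esub> w"
    and f: "inj_on f (verts G - {y})" "f y = f x" "\<forall>v\<in>verts G. f v \<in> L v"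
  shows "properly_list_distinguishable G L"
  unfolding properly_list_distinguishable_def
proof (intro exI[of _ f] conjI allI impI f(3))
  have eq: "u = v \<or> (u = x \<and> v = y) \<or> (u = y \<and> v = x)"
    if "f u = f v" "u \<in> verts G" "v \<in> verts G" for u v
  proof -
    have "x \<in> verts G - {y}"
      using xy(1) w by auto
    then have "v = x" if "f v = f y" "v \<in> verts G" "v \<noteq> y" for v
      using that f(1,2) by (auto dest: inj_onD)
    then show ?thesis
      using that f(1) by (cases "u = y"; cases "v = y") (auto dest: inj_onD)
  qed
  have "\<not> y \<rightarrow>\<^bsub>G\<^esub> x"
    using xy(2) sym_arcs arcs_ends_symmetric by metis
  then show "proper_coloring G f"
    unfolding proper_coloring_def using eq xy(2) adj_not_same adj_in_verts by metis
  fix \<phi>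
  assume \<phi>: "automorphism G \<phi> \<and> (\<forall>v\<in>verts G. f (\<phi> v) = f v)"
  have V: "\<phi> v \<in> verts G" if "v \<in> verts G" for v
    using \<phi> that by (auto simp: automorphism_def dest: bij_betwE)
  have fix_or_swap: "\<phi> v = v \<or> (\<phi> v = x \<and> v = y) \<or> (\<phi> v = y \<and> v = x)"
    if "v \<in> verts G" for v
    using eq[of "\<phi> v" v] \<phi> V that by blast
  have wV: "w \<in> verts G" "w \<noteq> x" "w \<noteq> y"
    using w(1) xy(2) adj_not_same adj_in_verts by auto
  then have "\<phi> w = w"
    using fix_or_swap by blast
  moreover have "\<phi> x \<rightarrow>\<^bsub>G\<^esub> \<phi> w"
    using \<phi> xy(1) wV(1) w(1) by (auto simp: automorphism_def)
  ultimately have x: "\<phi> x = x"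
    using fix_or_swap[OF xy(1)] w(2) by auto
  show "\<forall>v\<in>verts G. \<phi> v = v"
  proof
    fix v
    assume v: "v \<in> verts G"
    have "\<phi> v = \<phi> x \<longrightarrow> v = x"
      using \<phi> v xy(1) by (auto simp: automorphism_def bij_betw_def dest: inj_onD)
    then show "\<phi> v = v"
      using fix_or_swap[OF v] x by metis
  qed
qed

lemma list_distinguishing_chromatic_number_le_card:
  "list_distinguishing_chromatic_number G \<le> card (verts G)"
  unfolding list_distinguishing_chromatic_number_def
proof (rule Least_le, intro allI impI)
  fix L :: "'a \<Rightarrow> nat set"
  assume "\<forall>v\<in>verts G. finite (L v) \<and> card (L v) = card (verts G)"
  then obtain f where "inj_on f (verts G)" "\<forall>v\<in>verts G. f v \<in> L v"
    using ex_inj_on_choice[of "verts G" L] by auto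
  then show "properly_list_distinguishable G L"
    by (rule inj_on_imp_properly_list_distinguishable)
qed

text \<open>
  If all lists are the same set, of one color less than vertices, then some two vertices must
  share a color. They are to be nonadjacent vertices with different neighborhoods.
\<close>

lemma list_distinguishing_chromatic_number_le_pred_card:
  assumes xy: "x \<in> verts G" "y \<in> verts G" "\<not> x \<rightarrow>\<^bsub>G\<^esub> y"
    and w: "x \<rightarrow>\<^bsub>G\<^esub> w" "\<not> y \<rightarrow>\<^bsub>G\<^esub> w"
  shows "list_distinguishing_chromatic_number G \<le> card (verts G) - 1"
  unfolding list_distinguishing_chromatic_number_def
proof (rule Least_le, intro allI impI)
  fix L :: "'a \<Rightarrow> nat set"
  assume L: "\<forall>v\<in>verts G. finite (L v) \<and> card (L v) = card (verts G) - 1"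
  show "properly_list_distinguishable G L"
  proof (cases "\<forall>u\<in>verts G. \<forall>v\<in>verts G. L u = L v")
    case False
    then obtain u v where "u \<in> verts G" "v \<in> verts G" "L u \<noteq> L v"
      by blast
    then obtain f where "inj_on f (verts G)" "\<forall>v\<in>verts G. f v \<in> L v"
      using ex_inj_on_choice_pred[of "verts G" L u v] L by (metis finite_verts)
    then show ?thesis
      by (rule inj_on_imp_properly_list_distinguishable)
  next
    case True
    have "card (verts G - {y}) = card (verts G) - 1"
      using xy(2) by simp
    then obtain f where f: "inj_on f (verts G - {y})" "\<forall>v\<in>verts G - {y}. f v \<in> L v"
      using ex_inj_on_choice[of "verts G - {y}" L] L by auto
    have "x \<noteq> y"
      using w by auto
    define g where "g = f(y := f x)"
    have "inj_on g (verts G - {y})" "g y = g x"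
      using f(1) \<open>x \<noteq> y\<close> by (auto simp: g_def inj_on_def)
    moreover have "\<forall>v\<in>verts G. g v \<in> L v"
    proof
      fix v
      assume v: "v \<in> verts G"
      have "f x \<in> L y"
        using f(2) True xy(1,2) \<open>x \<noteq> y\<close> by blast
      then show "g v \<in> L v"
        using f(2) v by (simp add: g_def)
    qed
    ultimately show ?thesis
      using one_coincidence_imp_properly_list_distinguishable[OF xy(1,3) w] by blast
  qed
qed

section \<open>Regular graphs whose nonadjacent vertices are twins\<close>

text \<open>
  If nonadjacent vertices always have equal neighborhoods, nonadjacency is an equivalence relation;
  its classes, the parts of a complete multipartite graph, are the sets of non-neighbors and have
  \<open>card (verts G) - d\<close> elements each.
\<close>

lemma regular_ex_nonadjacent_nontwins:
  assumes reg: "\<And>v. v \<in> verts G \<Longrightarrow> out_degree G v = d"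
    and ndvd: "\<not> (card (verts G) - d) dvd card (verts G)"
  obtains x y w where "x \<in> verts G" "y \<in> verts G" "\<not> x \<rightarrow>\<^bsub>G\<^esub> y" "x \<rightarrow>\<^bsub>G\<^esub> w" "\<not> y \<rightarrow>\<^bsub>G\<^esub> w"
proof -
  define R where "R = {(x, y). x \<in> verts G \<and> y \<in> verts G \<and> \<not> x \<rightarrow>\<^bsub>G\<^esub> y}"
  have symG: "u \<rightarrow>\<^bsub>G\<^esub> v \<Longrightarrow> v \<rightarrow>\<^bsub>G\<^esub> u" for u v
    using sym_arcs arcs_ends_symmetric by metis
  have "card (R `` {x}) = card (verts G) - d" if x: "x \<in> verts G" for x
  proof -
    have "R `` {x} = verts G - {w. x \<rightarrow>\<^bsub>G\<^esub> w}"
      using x by (auto simp: R_def)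
    moreover have "{w. x \<rightarrow>\<^bsub>G\<^esub> w} \<subseteq> verts G"
      using adj_in_verts by auto
    ultimately show ?thesis
      using card_neighbors[of x] reg[OF x]
      by (simp add: card_Diff_subset finite_subset[OF _ finite_verts])
  qed
  then have "card X = card (verts G) - d" if "X \<in> verts G // R" for X
    using that by (auto elim: quotientE)
  then have "\<not> equiv (verts G) R"
    using equiv_imp_dvd_card[of "verts G" R "card (verts G) - d"] ndvd by auto
  moreover have "R \<subseteq> verts G \<times> verts G" "refl_on (verts G) R" "sym R"
    using adj_not_same symG by (auto simp: R_def refl_on_def sym_def)
  ultimately have "\<not> trans R"
    by (auto simp: equiv_def)
  then obtain a b c where abc: "(a, b) \<in> R" "(b, c) \<in> R" "(a, c) \<notin> R"
    by (auto simp: trans_def)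
  show ?thesis
    using that[of a b c] abc by (auto simp: R_def)
qed

end

section \<open>The bound\<close>

text \<open>
  As \<open>q (r + 1) \<le> D + 2\<close>, it suffices that \<open>q (r + 1) + 3 \<ge> 3 q + 2 r\<close>, that is,
  \<open>q (r - 2) \<ge> 2 r - 3\<close>. This holds for \<open>q \<ge> 3\<close>, and it fails by one for \<open>q = 2\<close>, where \<open>D > 2 r\<close>
  makes up for it.
\<close>

lemma quotient_bound:
  fixes D r q :: nat
  assumes "4 \<le> r" "2 * r \<le> D" "q = (D + 2) div (r + 1)" "D \<noteq> 2 * r"
  shows "3 * q + 2 * r \<le> D + 5"
proof (cases "q \<le> 2")
  case True
  then show ?thesis
    using assms by linarith
next
  case False
  have "q * (r + 1) \<le> D + 2"
    unfolding assms(3) by (rule div_times_less_eq_dividend)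
  moreover have "3 * (r - 2) \<le> q * (r - 2)"
    using False by (intro mult_right_mono) auto
  moreover have "q * (r + 1) = q * (r - 2) + 3 * q"
    using assms(1) by (simp flip: add_mult_distrib2 add: mult.commute[of 3])
  ultimately show ?thesis
    using assms(1) by linarith
qed

theorem theorem1p7:
  fixes G :: "('a, 'b) pre_digraph" and n r :: nat
  assumes "graph G"
    and "card (verts G) = n"
    and "4 \<le> r" and "real r \<le> real (max_degree G) / 2"
    and "n > 2 * r"
    and "k_connected (n - 2 * r + 1) G"
    and "\<not> (\<exists>H. induced_subgraph H G \<and> complete_bipartite_digraph r (r + 1) H)"
    and "\<not> (\<exists>H. induced_subgraph H G \<and> complete_bipartite_digraph (r + 1) (r + 1) H)"
  shows "int (list_distinguishing_chromatic_number G)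
    \<le> 2 * int (max_degree G) - (3 * \<lfloor>real (max_degree G + 2) / real (r + 1)\<rfloor> - 4)"
proof -
  interpret graph G by (rule assms(1))
  let ?\<chi> = "list_distinguishing_chromatic_number G"
  define D where "D = max_degree G"
  define q where "q = (D + 2) div (r + 1)"
  have floor: "\<lfloor>real (max_degree G + 2) / real (r + 1)\<rfloor> = int q"
    unfolding q_def D_def by (rule floor_divide_of_nat_eq)
  have D: "2 * r \<le> D"
    using assms(4) by (simp add: D_def)
  have deg: "n - 2 * r + 1 \<le> out_degree G v" "out_degree G v \<le> D" if "v \<in> verts G" for v
    using k_connected_le_out_degree[OF assms(6) that] out_degree_le_max_degree[OF that]
    by (auto simp: D_def)
  have "verts G \<noteq> {}"
    using assms(2,5) by auto
  then have n: "n + 1 \<le> D + 2 * r"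
    using deg assms(5) by fastforce
  have chi: "?\<chi> \<le> n"
    using list_distinguishing_chromatic_number_le_card assms(2) by simp
  have "?\<chi> + 3 * q \<le> 2 * D + 4"
  proof (cases "D = 2 * r")
    case False
    then show ?thesis
      using quotient_bound[OF assms(3) D q_def] n chi by linarith
  next
    case True
    then have q: "q = 2"
      using assms(3) by (simp add: q_def div_nat_eqI)
    show ?thesis
    proof (cases "n + 1 = 4 * r")
      case False
      then show ?thesis
        using n chi q True by linarith
    next
      case n_eq: True
      have reg: "out_degree G v = 2 * r" if "v \<in> verts G" for v
        using deg[OF that] n_eq True by linarith
      define m where "m = card (verts G) - 2 * r"
      have m: "card (verts G) = m * 2 + 1" "m \<noteq> 1"
        using assms(2,3) n_eq by (auto simp: m_def)
      then have "\<not> m dvd card (verts G)"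
        by (metis dvd_add_right_iff dvd_triv_left nat_dvd_1_iff_1)
      then have "\<not> (card (verts G) - 2 * r) dvd card (verts G)"
        by (simp only: m_def not_False_eq_True)
      from regular_ex_nonadjacent_nontwins[OF reg this]
      have "?\<chi> \<le> n - 1"
        using list_distinguishing_chromatic_number_le_pred_card assms(2) by metis
      then show ?thesis
        using n_eq q True assms(3) by linarith
    qed
  qed
  then show ?thesis
    unfolding floor by (simp add: D_def)
qed

end
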